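(* For $n\ge 3$, let $D_n$ be the $n$-vertex digraph with adjacency matrix $J-I$, where $J$ is the $n\times n$ all-ones matrix and $I$ is the $n\times n$ identity matrix. Then $$f(D_n)=f^*(D_n)=l(D_n)=l^*(D_n)=w(P(D_n))=n.$$
   Context: A digraph $D$ is finite with nonempty vertex set $V(D)$, and is identified with a relation $D\subseteq V(D)\times V(D)$ (its set of edges; loops are allowed, no multiple edges). Its adjacency matrix has entry $1$ in position $(u,v)$ if $uv$ is an edge and $0$ otherwise. $\overline{D}=(V(D)\times V(D))\setminus D$ is its complement. A digraph is a Ferrers digraph if its successor sets $\{u: vu\in E\}$, over all vertices $v$, are linearly ordered by inclusion; equivalently, its adjacency matrix has no $2\times 2$ permutation submatrix (two rows and two columns, not necessarily consecutive). The Ferrers dimension $f(D)$ is the minimum number of Ferrers digraphs on $V(D)$ whose intersection is $D$, equivalently the minimum number of Ferrers digraphs on $V(D)$ whose union is $\overline{D}$. $f^*(D)$ is the minimum number of pairwise disjoint Ferrers digraphs on $V(D)$ (as edge sets) whose union is $\overline{D}$. Trees are finite; a leaf is a vertex of degree 1. Subtrees are nonempty connected subgraphs. A subtree representation of $D$ in a host tree $T$ assigns to each vertex $v$ an ordered pair $(S_v,T_v)$ of subtrees of $T$ (source subtree and sink subtree) such that $uv$ is an edge of $D$ if and only if $S_u$ and $T_v$ have a common vertex (for all $u,v\in V(D)$, including $u=v$). The leafage $l(D)$ is the minimum number of leaves of a host tree in which $D$ has a subtree representation. The catch leafage $l^*(D)$ is the minimum number of leaves of a host tree in which $D$ has a subtree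 representation where every sink subtree $T_v$ is a single vertex. The incidence poset $P(D)$ is the collection of predecessor sets $\{u\in V(D): uv\in E(D)\}$, $v\in V(D)$, ordered by inclusion; $w(P)$ denotes the width (maximum size of an antichain) of a poset $P$. *)

theory Defs
  imports "Graph_Theory.Digraph_Component"
begin

text \<open>
  A digraph is a record \<open>pverts\<close>, \<open>parcs\<close> satisfying \<^locale>\<open>pair_fin_digraph\<close>:
  the vertex set is finite and the arcs form a relation on it, with loops allowed.
\<close>

definition adjacency_matrix :: "'a pair_pre_digraph \<Rightarrow> 'a \<Rightarrow> 'a \<Rightarrow> int" where
  "adjacency_matrix D u v = (if (u, v) \<in> parcs D then 1 else 0)"

definition complement_arcs :: "'a pair_pre_digraph \<Rightarrow> 'a rel" where
  "complement_arcs D = (pverts D \<times> pverts D) - parcs D"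


section \<open>Ferrers dimension\<close>

definition successors :: "'a pair_pre_digraph \<Rightarrow> 'a \<Rightarrow> 'a set" where
  "successors D v = {u \<in> pverts D. (v, u) \<in> parcs D}"

definition ferrers_digraph :: "'a pair_pre_digraph \<Rightarrow> bool" where
  "ferrers_digraph F \<longleftrightarrow> pair_fin_digraph F \<and> chain\<^sub>\<subseteq> (successors F ` pverts F)"

definition ferrers_family :: "'a set \<Rightarrow> 'a pair_pre_digraph set \<Rightarrow> bool" where
  "ferrers_family V \<F> \<longleftrightarrow> finite \<F> \<and> (\<forall>F\<in>\<F>. ferrers_digraph F \<and> pverts F = V)"

text \<open>
  The intersection is taken inside \<open>V(D) \<times> V(D)\<close>, so that the empty family has the complete
  digraph with all loops as its intersection, in agreement with the description by unions.
\<close>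

definition ferrers_dimension :: "'a pair_pre_digraph \<Rightarrow> nat" where
  "ferrers_dimension D = (LEAST k. \<exists>\<F>. ferrers_family (pverts D) \<F> \<and> card \<F> = k \<and>
     (pverts D \<times> pverts D) \<inter> (\<Inter>F\<in>\<F>. parcs F) = parcs D)"

definition disjoint_ferrers_dimension :: "'a pair_pre_digraph \<Rightarrow> nat" where
  "disjoint_ferrers_dimension D = (LEAST k. \<exists>\<F>. ferrers_family (pverts D) \<F> \<and> card \<F> = k \<and>
     pairwise (\<lambda>F G. parcs F \<inter> parcs G = {}) \<F> \<and>
     (\<Union>F\<in>\<F>. parcs F) = complement_arcs D)"


section \<open>Leafage\<close>

text \<open>
  An undirected graph is a symmetric loop-free digraph (\<^locale>\<open>pair_graph\<close>). Each edge is
  then a directed cycle of length 2, so the library's \<^const>\<open>tree\<close>, which forbids all directed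
  cycles, cannot be used; cycles of an undirected graph have length at least 3.
\<close>

definition undirected_tree :: "'t pair_pre_digraph \<Rightarrow> bool" where
  "undirected_tree T \<longleftrightarrow> pair_graph T \<and> connected (with_proj T) \<and>
     \<not> (\<exists>p. pre_digraph.cycle (with_proj T) p \<and> 3 \<le> length p)"

text \<open>By symmetry, the out-degree of a vertex is its degree in the undirected graph.\<close>

definition leaves :: "'t pair_pre_digraph \<Rightarrow> 't set" where
  "leaves T = {v \<in> pverts T. out_degree (with_proj T) v = 1}"

text \<open>The library's \<^const>\<open>connected\<close> includes nonemptiness.\<close>

definition subtree :: "'t pair_pre_digraph \<Rightarrow> 't pair_pre_digraph \<Rightarrow> bool" where
  "subtree S T \<longleftrightarrow> pair_graph S \<and> subgraph (with_proj S) (with_proj T) \<and> connected (with_proj S)"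

text \<open>\<open>S v\<close> is the source subtree and \<open>R v\<close> the sink subtree of \<open>v\<close>.\<close>

definition subtree_representation ::
  "'a pair_pre_digraph \<Rightarrow> 't pair_pre_digraph \<Rightarrow> ('a \<Rightarrow> 't pair_pre_digraph)
     \<Rightarrow> ('a \<Rightarrow> 't pair_pre_digraph) \<Rightarrow> bool" where
  "subtree_representation D T S R \<longleftrightarrow>
     (\<forall>v\<in>pverts D. subtree (S v) T \<and> subtree (R v) T) \<and>
     (\<forall>u\<in>pverts D. \<forall>v\<in>pverts D.
        (u, v) \<in> parcs D \<longleftrightarrow> pverts (S u) \<inter> pverts (R v) \<noteq> {})"

text \<open>
  Host trees are finite, so taking natural numbers as their vertices loses no generality.
\<close>

definition leafage :: "'a pair_pre_digraph \<Rightarrow> nat" where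
  "leafage D = (LEAST k. \<exists>(T :: nat pair_pre_digraph) S R.
     undirected_tree T \<and> card (leaves T) = k \<and> subtree_representation D T S R)"

definition catch_leafage :: "'a pair_pre_digraph \<Rightarrow> nat" where
  "catch_leafage D = (LEAST k. \<exists>(T :: nat pair_pre_digraph) S R.
     undirected_tree T \<and> card (leaves T) = k \<and> subtree_representation D T S R \<and>
     (\<forall>v\<in>pverts D. is_singleton (pverts (R v))))"


section \<open>Width of the incidence poset\<close>

definition predecessors :: "'a pair_pre_digraph \<Rightarrow> 'a \<Rightarrow> 'a set" where
  "predecessors D v = {u \<in> pverts D. (u, v) \<in> parcs D}"

text \<open>A poset is a finite subset of a type of class \<^class>\<open>order\<close>; for sets the order is inclusion.\<close>

definition incidence_poset :: "'a pair_pre_digraph \<Rightarrow> 'a set set" where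
  "incidence_poset D = predecessors D ` pverts D"

definition antichain :: "'b::order set \<Rightarrow> bool" where
  "antichain A \<longleftrightarrow> pairwise (\<lambda>x y. \<not> x \<le> y) A"

definition width :: "'b::order set \<Rightarrow> nat" where
  "width P = Max (card ` {A. A \<subseteq> P \<and> antichain A})"

end

(* A Ferrers digraph that contains D omits at most one loop, and one that is contained in the
   complement of D has at most one loop; this settles f and f*. A star with one leaf per vertex
   shows l* \<le> n. For l \<ge> n, pick for each vertex v a tree edge separating S_v from T_v and let
   A_v be the side containing S_v. For u \<noteq> v the sides A_u and A_v are incomparable because S_u
   meets T_v and S_v meets T_u, so they are disjoint or cover the tree. Then either all sides or
   all their complements are pairwise disjoint, and each side of a tree edge contains a leaf. *)

theory Submission
  imports Defs
begin

section \<open>Edge cuts in trees\<close>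

text \<open>Connectivity stated through cuts instead of walks: every nonempty proper part of
  \<open>X\<close> is left by an edge that stays in \<open>X\<close>. For symmetric \<open>E\<close>
  this is connectedness of the graph induced on \<open>X\<close>.\<close>

definition joined :: "'t rel \<Rightarrow> 't set \<Rightarrow> bool" where
  "joined E X \<longleftrightarrow> X \<noteq> {} \<and> (\<forall>Y. Y \<noteq> {} \<longrightarrow> Y \<subset> X \<longrightarrow> (\<exists>y\<in>Y. \<exists>x\<in>X - Y. (y, x) \<in> E))"

lemma joined_edge:
  assumes "joined E X" "Y \<noteq> {}" "Y \<subset> X"
  obtains y x where "y \<in> Y" "x \<in> X - Y" "(y, x) \<in> E"
  using assms unfolding joined_def by meson

lemma joined_mono:
  assumes "joined E X" "E \<subseteq> F"
  shows "joined F X"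
  using assms unfolding joined_def by blast

lemma joined_insert:
  assumes E: "sym E" and X: "joined E X" and xy: "x \<in> X" "(x, y) \<in> E"
  shows "joined E (insert y X)"
  unfolding joined_def
proof (intro conjI allI impI)
  fix Y assume Y: "Y \<noteq> {}" "Y \<subset> insert y X"
  show "\<exists>u\<in>Y. \<exists>v\<in>insert y X - Y. (u, v) \<in> E"
  \<comment> \<open>In the first case \<open>Y\<close> is \<open>{y}\<close> or \<open>X\<close>,
    and the new edge leaves it in one of its two directions; otherwise \<open>Y\<close> splits
    \<open>X\<close> itself.\<close>
  proof (cases "Y \<inter> X = {} \<or> X \<subseteq> Y")
    case True
    have "(y, x) \<in> E" using E xy by (auto dest: symD)
    with True Y xy show ?thesis by blast
  next
    case False
    then obtain u v where "u \<in> Y \<inter> X" "v \<in> X - Y \<inter> X" "(u, v) \<in> E"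
      using joined_edge[OF X, of "Y \<inter> X"] by blast
    then show ?thesis by blast
  qed
qed simp

text \<open>\<open>A\<close> is the side of \<open>a\<close> after the edge \<open>ab\<close> has
  been deleted. Only the outward direction is recorded; symmetry of \<open>E\<close> gives the other
  one.\<close>

definition edge_cut :: "'t set \<Rightarrow> 't rel \<Rightarrow> 't set \<Rightarrow> 't \<Rightarrow> 't \<Rightarrow> bool" where
  "edge_cut V E A a b \<longleftrightarrow> A \<subseteq> V \<and> E \<inter> A \<times> (V - A) = {(a, b)}"

lemma edge_cutD:
  assumes "edge_cut V E A a b"
  shows "A \<subseteq> V" "(a, b) \<in> E" "a \<in> A" "b \<in> V" "b \<notin> A"
    "\<And>x y. \<lbrakk>(x, y) \<in> E; x \<in> A; y \<in> V; y \<notin> A\<rbrakk> \<Longrightarrow> x = a \<and> y = b"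
  using assms unfolding edge_cut_def by blast+

text \<open>A finite tree with acyclicity replaced by the property that the cut arguments use: every
  edge is a bridge.\<close>

locale edge_tree =
  fixes V :: "'t set" and E :: "'t rel"
  assumes finite_V: "finite V"
    and E_V: "E \<subseteq> V \<times> V"
    and sym_E: "sym E"
    and joined_V: "joined E V"
    and bridge: "(a, b) \<in> E \<Longrightarrow> \<exists>A. edge_cut V E A a b"
begin

lemma cut_compl:
  assumes "edge_cut V E A a b"
  shows "edge_cut V E (V - A) b a"
proof -
  have "(x, y) \<in> E \<longleftrightarrow> (y, x) \<in> E" for x y using sym_E by (meson symD)
  then have "E \<inter> (V - A) \<times> (V - (V - A)) = {(b, a)}"
    using edge_cutD[OF assms] by blast
  then show ?thesis unfolding edge_cut_def by blast
qed

text \<open>A connected set that meets both sides must use the only crossing edge, hence contain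
  both of its ends.\<close>

lemma joined_subset_cut:
  assumes A: "edge_cut V E A a b" and X: "joined E X" "X \<subseteq> V" "X \<inter> A \<noteq> {}"
    and ends: "a \<notin> X \<or> b \<notin> X"
  shows "X \<subseteq> A"
proof (rule ccontr)
  assume "\<not> X \<subseteq> A"
  then have "X \<inter> A \<subset> X" by blast
  with X obtain y x where "y \<in> X \<inter> A" "x \<in> X - X \<inter> A" "(y, x) \<in> E"
    using joined_edge by metis
  then show False using edge_cutD(6)[OF A, of y x] ends X by blast
qed

lemma separating_cut:
  assumes S: "joined E S" "S \<subseteq> V" and R: "joined E R" "R \<subseteq> V" and disj: "S \<inter> R = {}"
  obtains A a b where "edge_cut V E A a b" "S \<subseteq> A" "R \<inter> A = {}"
proof -
  \<comment> \<open>Grow \<open>R\<close> to a maximal connected set \<open>C\<close> that avoids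
    \<open>S\<close>. By maximality every edge leaving \<open>C\<close> ends in \<open>S\<close>,
    and such an edge gives the cut.\<close>
  let ?M = "{X. X \<subseteq> V - S \<and> R \<subseteq> X \<and> joined E X}"
  have fin: "finite ?M" using finite_V by simp
  have "?M \<noteq> {}" using R disj by blast
  from finite_has_maximal[OF fin this]
  obtain C where C: "C \<in> ?M" and max: "\<forall>X\<in>?M. C \<subseteq> X \<longrightarrow> C = X"
    by (elim bexE)
  have "C \<noteq> {}" using C unfolding joined_def by blast
  moreover have "C \<subset> V" using C S unfolding joined_def by blast
  ultimately obtain c s where cs: "c \<in> C" "s \<in> V - C" "(c, s) \<in> E"
    using joined_edge[OF joined_V] by metis
  have "s \<in> S"
  proof (rule ccontr)
    assume "s \<notin> S"
    then have "insert s C \<in> ?M" using C cs joined_insert[OF sym_E, of C c s] by blast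
    then show False using max cs by blast
  qed
  have "(s, c) \<in> E" using cs sym_E by (auto dest: symD)
  then obtain A where A: "edge_cut V E A s c" using bridge by blast
  \<comment> \<open>\<open>S\<close> misses the end \<open>c\<close> and \<open>C\<close> misses the
    end \<open>s\<close>, so neither of them crosses the cut.\<close>
  have "S \<subseteq> A"
    using joined_subset_cut[OF A S] edge_cutD[OF A] \<open>s \<in> S\<close> C cs by blast
  moreover have "C \<inter> A = {}"
    using joined_subset_cut[OF A, of C] edge_cutD[OF A] cs C by blast
  ultimately show thesis using that A C by blast
qed

text \<open>Each of the four quadrants of two cuts would need a leaving edge, but two edges
  cannot hold the four quadrants together.\<close>

lemma cuts_laminar:
  assumes A: "edge_cut V E A a b" and B: "edge_cut V E B c d"
  shows "A \<inter> B = {} \<or> A \<subseteq> B \<or> B \<subseteq> A \<or> A \<union> B = V"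
proof (rule ccontr)
  assume neg: "\<not> ?thesis"
  note A' = edge_cutD[OF A] and B' = edge_cutD[OF B]
  \<comment> \<open>An edge that changes sides of a cut is the cut edge in one of its directions, so
    the side it starts from determines its start.\<close>
  have cross: "(y \<in> A \<and> x \<notin> A \<longrightarrow> y = a) \<and> (y \<notin> A \<and> x \<in> A \<longrightarrow> y = b) \<and>
      (y \<in> B \<and> x \<notin> B \<longrightarrow> y = c) \<and> (y \<notin> B \<and> x \<in> B \<longrightarrow> y = d)"
    if "(y, x) \<in> E" for y x
    using that A'(6)[of y x] B'(6)[of y x] A'(6)[of x y] B'(6)[of x y] E_V sym_E
    by (auto dest: symD)
  have leave: "\<exists>y\<in>Q. \<exists>x. x \<notin> Q \<and> (y, x) \<in> E" if "Q \<noteq> {}" "Q \<subset> V" for Q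
    using joined_edge[OF joined_V that] by blast
  have proper: "A \<inter> B \<subset> V" "A - B \<subset> V" "B - A \<subset> V" "V - A - B \<subset> V"
    using neg A'(1) B'(1) by blast+
  have "\<exists>y\<in>A \<inter> B. \<exists>x. x \<notin> A \<inter> B \<and> (y, x) \<in> E"
    using leave[OF _ proper(1)] neg by blast
  then have q1: "a \<in> A \<inter> B \<or> c \<in> A \<inter> B" using cross by blast
  have "\<exists>y\<in>A - B. \<exists>x. x \<notin> A - B \<and> (y, x) \<in> E"
    using leave[OF _ proper(2)] neg by blast
  then have q2: "a \<in> A - B \<or> d \<in> A - B" using cross by blast
  have "\<exists>y\<in>B - A. \<exists>x. x \<notin> B - A \<and> (y, x) \<in> E"
    using leave[OF _ proper(3)] neg by blast
  then have q3: "b \<in> B - A \<or> c \<in> B - A" using cross by blast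
  have "V - A - B \<noteq> {}" using neg A'(1) B'(1) by blast
  then have "\<exists>y\<in>V - A - B. \<exists>x. x \<notin> V - A - B \<and> (y, x) \<in> E"
    using leave[OF _ proper(4)] by blast
  then have q4: "b \<in> V - A - B \<or> d \<in> V - A - B" using cross E_V by blast
  have "(d, c) \<in> E" using sym_E B'(2) by (auto dest: symD)
  then have cd: "c \<in> A \<Longrightarrow> d \<notin> A \<Longrightarrow> c = a \<and> d = b" "d \<in> A \<Longrightarrow> c \<notin> A \<Longrightarrow> d = a \<and> c = b"
    using A'(6) B' by blast+
  \<comment> \<open>If \<open>c\<close> and \<open>d\<close> lie on the same side of
    \<open>A\<close>, the two quadrants on the other side both need the single end of
    \<open>ab\<close> found there. If not, \<open>cd\<close> is \<open>ab\<close> up to direction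
    and its two ends serve only two quadrants.\<close>
  show False
    using q1 q2 q3 q4 cd A'(3,5) B'(3,5) by blast
qed

text \<open>If \<open>a\<close> is not itself a leaf, it has a neighbour \<open>c\<close> in
  \<open>A\<close>, and the side of \<open>c\<close> with respect to the edge \<open>ca\<close> is a
  strictly smaller cut inside \<open>A\<close>.\<close>

lemma leaf_in_cut:
  assumes "edge_cut V E A a b"
  shows "\<exists>v\<in>A. \<exists>w. E `` {v} = {w}"
  using assms
proof (induction "card A" arbitrary: A a b rule: less_induct)
  case less
  note A = edge_cutD[OF less.prems]
  show ?case
  proof (cases "E `` {a} = {b}")
    case True
    then show ?thesis using A by blast
  next
    case False
    then obtain c where c: "(a, c) \<in> E" "c \<noteq> b" using A by blast
    then have "c \<in> A" using A E_V by blast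
    have "(c, a) \<in> E" using c sym_E by (auto dest: symD)
    then obtain C where C: "edge_cut V E C c a" using bridge by blast
    note C' = edge_cutD[OF C]
    have "C \<subseteq> A"
    proof (rule ccontr)
      assume "\<not> C \<subseteq> A"
      then have "C - A \<noteq> {}" "C - A \<subset> V" using A(1,3) C'(1) by blast+
      \<comment> \<open>This edge either leaves \<open>C\<close>, and then starts at
        \<open>c\<close>, which lies in \<open>A\<close>; or it enters \<open>A\<close> inside
        \<open>C\<close>, and then ends at \<open>a\<close>, which lies outside
        \<open>C\<close>.\<close>
      then obtain y x where yx: "y \<in> C - A" "x \<in> V - (C - A)" "(y, x) \<in> E"
        using joined_edge[OF joined_V] by metis
      have "(x, y) \<in> E" using yx sym_E by (auto dest: symD)
      then show False using yx A C' \<open>c \<in> A\<close> by blast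
    qed
    then have "C \<subset> A" using A C' by blast
    then have "card C < card A" using finite_V A(1) by (meson finite_subset psubset_card_mono)
    then show ?thesis using less.hyps C \<open>C \<subseteq> A\<close> by blast
  qed
qed

text \<open>Each side holds a leaf, and disjointness makes the chosen leaves distinct.\<close>

lemma card_disjoint_cuts_le:
  assumes "\<forall>i\<in>I. \<exists>a b. edge_cut V E (A i) a b"
    and disj: "\<And>i j. \<lbrakk>i \<in> I; j \<in> I; i \<noteq> j\<rbrakk> \<Longrightarrow> A i \<inter> A j = {}"
  shows "card I \<le> card {v \<in> V. \<exists>w. E `` {v} = {w}}"
proof -
  have "\<exists>v. v \<in> A i \<inter> {v \<in> V. \<exists>w. E `` {v} = {w}}" if "i \<in> I" for i
  proof -
    obtain a b where "edge_cut V E (A i) a b" using assms(1) \<open>i \<in> I\<close> by blast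
    then show ?thesis using leaf_in_cut[of "A i"] edge_cutD(1)[of V E "A i"] by blast
  qed
  then have "\<forall>i\<in>I. \<exists>v. v \<in> A i \<inter> {v \<in> V. \<exists>w. E `` {v} = {w}}" by (rule ballI)
  from bchoice[OF this]
  obtain l where l: "\<forall>i\<in>I. l i \<in> A i \<inter> {v \<in> V. \<exists>w. E `` {v} = {w}}" ..
  have "inj_on l I"
  proof (rule inj_onI, rule ccontr)
    fix i j assume ij: "i \<in> I" "j \<in> I" "l i = l j" "i \<noteq> j"
    then have "l i \<in> A i \<inter> A j" using l by auto
    then show False using disj[OF ij(1,2,4)] by simp
  qed
  moreover have "l ` I \<subseteq> {v \<in> V. \<exists>w. E `` {v} = {w}}" using l by blast
  ultimately show ?thesis using finite_V by (simp add: card_inj_on_le)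
qed

lemma card_cross_intersecting_le:
  assumes S: "\<And>i. i \<in> I \<Longrightarrow> joined E (S i) \<and> S i \<subseteq> V"
    and R: "\<And>i. i \<in> I \<Longrightarrow> joined E (R i) \<and> R i \<subseteq> V"
    and meet: "\<And>i j. \<lbrakk>i \<in> I; j \<in> I\<rbrakk> \<Longrightarrow> S i \<inter> R j \<noteq> {} \<longleftrightarrow> i \<noteq> j"
  shows "card I \<le> card {v \<in> V. \<exists>w. E `` {v} = {w}}"
proof -
  \<comment> \<open>The diagonal case of \<open>meet\<close> makes \<open>S i\<close> and
    \<open>R i\<close> disjoint, so a cut separates them.\<close>
  have "\<forall>i\<in>I. \<exists>A. (\<exists>a b. edge_cut V E A a b) \<and> S i \<subseteq> A \<and> R i \<inter> A = {}"
    using separating_cut S R meet by metis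
  then obtain A where A: "\<forall>i\<in>I. (\<exists>a b. edge_cut V E (A i) a b) \<and> S i \<subseteq> A i \<and> R i \<inter> A i = {}"
    by metis
  have A_V: "A i \<subseteq> V" if "i \<in> I" for i using A that edge_cutD(1) by metis
  \<comment> \<open>Otherwise \<open>S i\<close> would lie in \<open>A j\<close>, which avoids
    \<open>R j\<close>, although \<open>S i\<close> meets \<open>R j\<close>.\<close>
  have incomp: "\<not> A i \<subseteq> A j" if "i \<in> I" "j \<in> I" "i \<noteq> j" for i j
    using A meet[of i j] that by blast
  have dichotomy: "A i \<inter> A j = {} \<or> A i \<union> A j = V" if "i \<in> I" "j \<in> I" "i \<noteq> j" for i j
    using A cuts_laminar incomp that by metis
  show ?thesis
  proof (cases "\<exists>i\<in>I. \<exists>j\<in>I. i \<noteq> j \<and> A i \<inter> A j = {}")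
    case True
    then obtain i j where ij: "i \<in> I" "j \<in> I" "i \<noteq> j" "A i \<inter> A j = {}" by blast
    \<comment> \<open>If \<open>A q\<close> and \<open>A r\<close> covered \<open>V\<close>, then
      \<open>A p\<close>, which avoids \<open>A q\<close>, would lie in \<open>A r\<close>. For
      \<open>p = r\<close> the claim is the assumption.\<close>
    have step: "A q \<inter> A r = {}"
      if "A p \<inter> A q = {}" "p \<in> I" "q \<in> I" "r \<in> I" "q \<noteq> r" for p q r
      using that dichotomy[of q r] incomp[of p r] A_V[of p] by blast
    \<comment> \<open>Disjointness passes from \<open>i, j\<close> to \<open>j, k\<close> and on to
      \<open>k, l\<close>; for \<open>k = j\<close> it passes directly to
      \<open>j, l\<close>.\<close>
    have "A k \<inter> A l = {}" if "k \<in> I" "l \<in> I" "k \<noteq> l" for k l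
      using step[of i j k] step[of j k l] step[of i j l] ij that by blast
    then show ?thesis using card_disjoint_cuts_le[of I A] A by blast
  next
    case False
    then have "(V - A k) \<inter> (V - A l) = {}" if "k \<in> I" "l \<in> I" "k \<noteq> l" for k l
      using dichotomy[OF that] that by blast
    moreover have "\<forall>i\<in>I. \<exists>a b. edge_cut V E (V - A i) a b" using A cut_compl by metis
    ultimately show ?thesis using card_disjoint_cuts_le[of I "\<lambda>i. V - A i"] by blast
  qed
qed

end


section \<open>Undirected trees\<close>

text \<open>Symmetric arcs turn connectedness into directed reachability, and a walk from inside
  \<open>Y\<close> to outside must leave \<open>Y\<close> by some arc.\<close>

lemma joined_if_connected:
  assumes X: "pair_graph X" and con: "connected (with_proj X)"
  shows "joined (parcs X) (pverts X)"
proof -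
  interpret pair_graph X by (fact X)
  have reach: "u \<rightarrow>\<^sup>*\<^bsub>with_proj X\<^esub> v" if "u \<in> pverts X" "v \<in> pverts X" for u v
    using symmetric_connected_imp_strongly_connected[OF sym_arcs con] that
    by (simp add: strongly_connected_def)
  show ?thesis
    unfolding joined_def
  proof (intro conjI allI impI)
    show "pverts X \<noteq> {}" using con by (auto simp: connected_def strongly_connected_def)
  next
    fix Y assume Y: "Y \<noteq> {}" "Y \<subset> pverts X"
    then obtain u v where u: "u \<in> Y" and v: "v \<in> pverts X" "v \<notin> Y" by blast
    then have uv: "u \<rightarrow>\<^sup>*\<^bsub>with_proj X\<^esub> v" using reach Y by blast
    show "\<exists>y\<in>Y. \<exists>x\<in>pverts X - Y. (y, x) \<in> parcs X"
    proof (rule ccontr)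
      assume none: "\<not> ?thesis"
      from uv have "v \<in> Y"
      proof (induction rule: reachable_induct)
        case (step x y)
        then show ?case using none in_arcsD2 by auto
      qed (rule u)
      then show False using v by blast
    qed
  qed
qed

lemma pawalk_verts_snoc: "pcas u p v \<Longrightarrow> pawalk_verts u (p @ [(v, w)]) = pawalk_verts u p @ [w]"
  by (induction p arbitrary: u) auto

text \<open>Delete the edge \<open>ab\<close> and let \<open>A\<close> be what \<open>a\<close>
  still reaches. If that included \<open>b\<close>, the remaining path closed by \<open>ba\<close>
  would be a forbidden cycle.\<close>

lemma undirected_tree_bridge:
  assumes T: "undirected_tree T" and ab: "(a, b) \<in> parcs T"
  shows "\<exists>A. edge_cut (pverts T) (parcs T) A a b"
proof -
  interpret T: pair_graph T using T by (simp add: undirected_tree_def)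
  define T' where "T' = \<lparr>pverts = pverts T, parcs = parcs T - {(a, b), (b, a)}\<rparr>"
  interpret T': pair_wf_digraph T'
    by unfold_locales (auto simp: T'_def dest: T.in_arcsD1 T.in_arcsD2)
  have neq: "a \<noteq> b" using T.pair_no_loops ab by fastforce
  have ba: "(b, a) \<in> parcs T" using T.sym_arcs ab by (auto simp: symmetric_def dest: symD)
  have verts: "a \<in> pverts T" "b \<in> pverts T" using T.in_arcsD1 T.in_arcsD2 ab by auto
  define A where "A = {x. a \<rightarrow>\<^sup>*\<^bsub>with_proj T'\<^esub> x}"
  have "b \<notin> A"
  proof
    assume "b \<in> A"
    then obtain p where p: "T'.apath a p b"
      using T'.reachable_apath by (auto simp: A_def)
    then have pw: "set p \<subseteq> parcs T'" "pcas a p b" "distinct (pawalk_verts a p)"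
      by (auto simp: T'.apath_def T'.awalk_def)
    \<comment> \<open>The path is not empty as \<open>a\<close> and \<open>b\<close> differ, and not
      a single arc as that arc was deleted. With \<open>ba\<close> added it has the length 3 that
      separates true cycles from an edge traversed back and forth.\<close>
    have "p \<noteq> []" using pw neq by auto
    moreover have "p \<noteq> [e]" for e using pw by (cases e) (auto simp: T'_def)
    ultimately have len: "2 \<le> length p" by (cases p; cases "tl p") auto
    have "T.awalk a (p @ [(b, a)]) a"
      unfolding T.awalk_def using pw ba verts by (auto simp: T'_def T.awlast_if_cas)
    moreover have "distinct (tl (pawalk_verts a (p @ [(b, a)])))"
      using pw \<open>p \<noteq> []\<close> by (cases p) (auto simp: pawalk_verts_snoc)
    ultimately have "T.cycle (p @ [(b, a)])" by (auto simp: T.cycle_def)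
    moreover have "3 \<le> length (p @ [(b, a)])" using len by simp
    ultimately show False using T unfolding undirected_tree_def by blast
  qed
  moreover have "a \<in> A" using verts T'.reachable_refl by (auto simp: A_def T'_def)
  moreover have "A \<subseteq> pverts T" using T'.reachable_in_verts by (auto simp: A_def T'_def)
  \<comment> \<open>An arc leaving the reachable set must be a deleted one, and
    \<open>(b, a)\<close> starts outside \<open>A\<close>.\<close>
  moreover have "(x, y) = (a, b)" if "(x, y) \<in> parcs T" "x \<in> A" "y \<notin> A" for x y
    using that T'.reachable_adj_trans[of a x y] \<open>b \<notin> A\<close> by (auto simp: A_def T'_def)
  ultimately have "edge_cut (pverts T) (parcs T) A a b"
    unfolding edge_cut_def using ab verts by blast
  then show ?thesis by blast
qed

lemma edge_tree_if_undirected_tree: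
  assumes T: "undirected_tree T"
  shows "edge_tree (pverts T) (parcs T)"
proof -
  interpret T: pair_graph T using T by (simp add: undirected_tree_def)
  show ?thesis
  proof (rule edge_tree.intro)
    show "finite (pverts T)" by (fact T.pair_finite_verts)
    show "parcs T \<subseteq> pverts T \<times> pverts T" by (auto dest: T.in_arcsD1 T.in_arcsD2)
    show "sym (parcs T)" using T.sym_arcs by (simp add: symmetric_def)
    show "joined (parcs T) (pverts T)"
      using T by (intro joined_if_connected) (simp_all add: undirected_tree_def)
    show "\<exists>A. edge_cut (pverts T) (parcs T) A a b" if "(a, b) \<in> parcs T" for a b
      using undirected_tree_bridge[OF T that] .
  qed
qed

text \<open>Replaces the count of outgoing arcs by a unique neighbour, the form in which
  \<open>leaf_in_cut\<close> finds leaves.\<close>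

lemma leaves_conv:
  "leaves T = {v \<in> pverts T. \<exists>w. parcs T `` {v} = {w}}"
proof -
  have "out_arcs (with_proj T) v = Pair v ` (parcs T `` {v})" for v
    by (auto simp: out_arcs_def)
  then have "out_degree (with_proj T) v = card (parcs T `` {v})" for v
    by (simp add: out_degree_def card_image inj_on_def)
  then show ?thesis by (auto simp: leaves_def card_1_singleton_iff)
qed

lemma card_le_leaves:
  assumes T: "undirected_tree T" and rep: "subtree_representation D T S R"
    and D: "parcs D = {(u, v) \<in> pverts D \<times> pverts D. u \<noteq> v}"
  shows "card (pverts D) \<le> card (leaves T)"
proof -
  interpret edge_tree "pverts T" "parcs T" by (rule edge_tree_if_undirected_tree[OF T])
  \<comment> \<open>A subtree is connected by its own edges, hence also by those of
    \<open>T\<close>.\<close>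
  have sub: "joined (parcs T) (pverts X) \<and> pverts X \<subseteq> pverts T" if "subtree X T" for X
    using that joined_if_connected[of X] joined_mono by (auto simp: subtree_def subgraph_def)
  show ?thesis
    unfolding leaves_conv
  proof (rule card_cross_intersecting_le)
    show "joined (parcs T) (pverts (S i)) \<and> pverts (S i) \<subseteq> pverts T" if "i \<in> pverts D" for i
      using sub rep that by (auto simp: subtree_representation_def)
    show "joined (parcs T) (pverts (R i)) \<and> pverts (R i) \<subseteq> pverts T" if "i \<in> pverts D" for i
      using sub rep that by (auto simp: subtree_representation_def)
    show "pverts (S i) \<inter> pverts (R j) \<noteq> {} \<longleftrightarrow> i \<noteq> j"
      if "i \<in> pverts D" "j \<in> pverts D" for i j
      using rep that unfolding subtree_representation_def by (simp add: D)
  qed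
qed


section \<open>Stars\<close>

text \<open>With \<open>X\<close> empty this is a single vertex, so one construction provides the
  host tree, the sources and the sinks.\<close>

definition star :: "'t \<Rightarrow> 't set \<Rightarrow> 't pair_pre_digraph" where
  "star c X = \<lparr>pverts = insert c X, parcs = {c} \<times> X \<union> X \<times> {c}\<rparr>"

lemma star_simps [simp]:
  "pverts (star c X) = insert c X" "parcs (star c X) = {c} \<times> X \<union> X \<times> {c}"
  by (simp_all add: star_def)

lemma pair_graph_star:
  assumes "finite X" "c \<notin> X"
  shows "pair_graph (star c X)"
  using assms by unfold_locales (auto simp: symmetric_def intro: symI)

lemma connected_star:
  assumes "finite X" "c \<notin> X"
  shows "connected (with_proj (star c X))"
proof -
  interpret pair_graph "star c X" by (rule pair_graph_star[OF assms])
  have "u \<rightarrow>\<^sup>*\<^bsub>with_proj (star c X)\<^esub> v" if "u \<in> insert c X" "v \<in> insert c X" for u v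
  proof -
    have "u \<rightarrow>\<^sup>*\<^bsub>with_proj (star c X)\<^esub> c" "c \<rightarrow>\<^sup>*\<^bsub>with_proj (star c X)\<^esub> v"
      using that reachable_adjI[of u c] reachable_adjI[of c v] reachable_refl[of c] by auto
    then show ?thesis by (rule reachable_trans)
  qed
  then show ?thesis
    unfolding connected_def by (intro strongly_connectedI) (auto intro: reachable_mk_symmetricI)
qed

lemma undirected_tree_star:
  assumes "finite X" "c \<notin> X"
  shows "undirected_tree (star c X)"
proof -
  interpret pair_graph "star c X" by (rule pair_graph_star[OF assms])
  have False if "cycle p" "3 \<le> length p" for p
  proof -
    obtain e1 e2 e3 q where p: "p = e1 # e2 # e3 # q"
      using \<open>3 \<le> length p\<close> by (metis One_nat_def Suc_le_length_iff numeral_3_eq_3)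
    obtain u where u: "set p \<subseteq> {c} \<times> X \<union> X \<times> {c}" "pcas u p u"
      "distinct (tl (pawalk_verts u p))"
      using \<open>cycle p\<close> by (auto simp: cycle_def awalk_def)
    have ends: "pcas x r y \<Longrightarrow> x \<in> set (pawalk_verts x r) \<and> y \<in> set (pawalk_verts x r)" for x r y
      by (induction r arbitrary: x) auto
    \<comment> \<open>The vertices alternate between centre and leaves. Starting from a leaf, the
      first and third arcs both end at \<open>c\<close>; starting from \<open>c\<close>, the second
      arc does, and so does the closing vertex, which \<open>ends\<close> locates after the third
      arc.\<close>
    show False
      using u \<open>c \<notin> X\<close> ends[of "snd e3" q u] by (auto simp: p)
  qed
  then show ?thesis
    using pair_graph_axioms connected_star[OF assms] unfolding undirected_tree_def by blast
qed

text \<open>For a one-element \<open>X\<close> the centre would be a leaf too.\<close>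

lemma leaves_star:
  assumes "finite X" "c \<notin> X" "card X \<noteq> 1"
  shows "leaves (star c X) = X"
proof -
  have "parcs (star c X) `` {c} = X" using assms(2) by auto
  moreover have "parcs (star c X) `` {x} = {c}" if "x \<in> X" for x using that assms(2) by auto
  moreover have "X \<noteq> {w}" for w using assms(3) by auto
  ultimately show ?thesis unfolding leaves_conv star_simps(1) by blast
qed

lemma subtree_star:
  assumes "finite X" "c \<notin> X" "Y \<subseteq> X"
  shows "subtree (star c Y) (star c X)"
proof -
  have Y: "finite Y" "c \<notin> Y" using assms finite_subset by auto
  interpret X: pair_graph "star c X" by (rule pair_graph_star) (use assms in blast)+
  interpret Y: pair_graph "star c Y" by (rule pair_graph_star[OF Y])
  show ?thesis
    unfolding subtree_def subgraph_def
    using assms Y.pair_graph_axioms connected_star[OF Y] X.wf_digraph Y.wf_digraph by auto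
qed

lemma subtree_vertex:
  assumes "finite X" "c \<notin> X" "x \<in> X"
  shows "subtree (star x {}) (star c X)"
proof -
  interpret X: pair_graph "star c X" by (rule pair_graph_star) (use assms in blast)+
  interpret Y: pair_graph "star x {}" by (rule pair_graph_star) auto
  show ?thesis
    unfolding subtree_def subgraph_def
    using assms Y.pair_graph_axioms connected_star[of "{}" x] X.wf_digraph Y.wf_digraph by auto
qed

text \<open>The sink of \<open>v\<close> is a leaf of its own, and the source of \<open>u\<close> is
  the star without the leaf of \<open>u\<close>; they miss each other exactly when
  \<open>u = v\<close>.\<close>

lemma star_catch_representation:
  assumes fin: "finite (pverts D)" and card: "card (pverts D) \<noteq> 1"
    and D: "parcs D = {(u, v) \<in> pverts D \<times> pverts D. u \<noteq> v}"
  shows "\<exists>(T :: nat pair_pre_digraph) S R. undirected_tree T \<and> card (leaves T) = card (pverts D) \<and>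
    subtree_representation D T S R \<and> (\<forall>v\<in>pverts D. is_singleton (pverts (R v)))"
proof -
  \<comment> \<open>Numbering the leaves from 1 keeps 0 free for the centre.\<close>
  obtain h :: "'a \<Rightarrow> nat" where h: "bij_betw h (pverts D) {1..card (pverts D)}"
    using finite_same_card_bij[OF fin, of "{1..card (pverts D)}"] by auto
  let ?X = "{1..card (pverts D)}"
  have inj: "h u = h v \<longleftrightarrow> u = v" if "u \<in> pverts D" "v \<in> pverts D" for u v
    using h that by (auto simp: bij_betw_def inj_on_def)
  have hX: "h u \<in> ?X" if "u \<in> pverts D" for u using h that by (auto simp: bij_betw_def)
  have "subtree_representation D (star 0 ?X) (\<lambda>v. star 0 (?X - {h v})) (\<lambda>v. star (h v) {})"
    unfolding subtree_representation_def
  proof (intro conjI ballI)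
    fix v assume v: "v \<in> pverts D"
    show "subtree (star 0 (?X - {h v})) (star 0 ?X)" by (rule subtree_star) auto
    show "subtree (star (h v) {}) (star 0 ?X)" using hX[OF v] by (intro subtree_vertex) auto
  next
    fix u v assume uv: "u \<in> pverts D" "v \<in> pverts D"
    show "(u, v) \<in> parcs D \<longleftrightarrow>
        pverts (star 0 (?X - {h u})) \<inter> pverts (star (h v) {}) \<noteq> {}"
      using uv hX[of v] inj[of u v] by (auto simp: D)
  qed
  moreover have "undirected_tree (star 0 ?X)" by (rule undirected_tree_star) auto
  moreover have "leaves (star 0 ?X) = ?X" using card by (intro leaves_star) auto
  ultimately show ?thesis
    by (intro exI[of _ "star 0 ?X"] exI[of _ "\<lambda>v. star 0 (?X - {h v})"]
        exI[of _ "\<lambda>v. star (h v) {}"]) (auto simp: is_singleton_def)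
qed


section \<open>Ferrers families\<close>

lemma ferrers_digraphD:
  assumes "ferrers_digraph F" "u \<in> pverts F" "v \<in> pverts F"
  shows "successors F u \<subseteq> successors F v \<or> successors F v \<subseteq> successors F u"
  using assms unfolding ferrers_digraph_def chain_subset_def by blast

text \<open>Two loops omitted at \<open>u\<close> and \<open>v\<close>, with the arcs
  \<open>uv\<close> and \<open>vu\<close> present, would form a 2 by 2 permutation
  submatrix.\<close>

lemma ferrers_dimension_eq:
  assumes fin: "finite (pverts D)"
    and D: "parcs D = {(u, v) \<in> pverts D \<times> pverts D. u \<noteq> v}"
  shows "ferrers_dimension D = card (pverts D)"
  unfolding ferrers_dimension_def
proof (rule Least_equality)
  let ?V = "pverts D"
  \<comment> \<open>Each member omits a single loop, so it has at most two distinct successor sets,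
    and they are nested.\<close>
  let ?F = "\<lambda>v. \<lparr>pverts = ?V, parcs = ?V \<times> ?V - {(v, v)}\<rparr>"
  have "ferrers_digraph (?F v)" for v
  proof -
    have "pair_fin_digraph (?F v)" by unfold_locales (use fin in auto)
    moreover have "successors (?F v) u = (if u = v then ?V - {v} else ?V)" if "u \<in> ?V" for u
      using that by (auto simp: successors_def)
    ultimately show ?thesis by (auto simp: ferrers_digraph_def chain_subset_def)
  qed
  then have "ferrers_family ?V (?F ` ?V)" using fin by (auto simp: ferrers_family_def)
  moreover have "card (?F ` ?V) = card ?V" by (rule card_image) (auto simp: inj_on_def)
  moreover have "(?V \<times> ?V) \<inter> (\<Inter>F\<in>?F ` ?V. parcs F) = parcs D" by (auto simp: D)
  ultimately show "\<exists>\<F>. ferrers_family ?V \<F> \<and> card \<F> = card ?V \<and>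
      (?V \<times> ?V) \<inter> (\<Inter>F\<in>\<F>. parcs F) = parcs D" by blast
next
  let ?V = "pverts D"
  fix k assume "\<exists>\<F>. ferrers_family ?V \<F> \<and> card \<F> = k \<and>
      (?V \<times> ?V) \<inter> (\<Inter>F\<in>\<F>. parcs F) = parcs D"
  then obtain \<F> where fam: "ferrers_family ?V \<F>" and k: "card \<F> = k"
    and int: "(?V \<times> ?V) \<inter> (\<Inter>F\<in>\<F>. parcs F) = parcs D" by blast
  \<comment> \<open>Every loop is missing from the intersection, so some member omits it; choosing
    such members injectively bounds the family from below.\<close>
  have "\<exists>F. F \<in> \<F> \<and> (v, v) \<notin> parcs F" if "v \<in> ?V" for v
    using int that by (auto simp: D)
  then obtain g where g: "\<And>v. v \<in> ?V \<Longrightarrow> g v \<in> \<F> \<and> (v, v) \<notin> parcs (g v)" by metis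
  have "inj_on g ?V"
  proof (rule inj_onI, rule ccontr)
    fix u v assume uv: "u \<in> ?V" "v \<in> ?V" "g u = g v" "u \<noteq> v"
    have F: "ferrers_digraph (g u)" "pverts (g u) = ?V"
      using fam g uv by (auto simp: ferrers_family_def)
    have "(u, v) \<in> parcs (g u)" "(v, u) \<in> parcs (g u)"
      using int g[OF uv(1)] uv by (auto simp: D)
    then have "v \<in> successors (g u) u" "u \<in> successors (g u) v"
      "u \<notin> successors (g u) u" "v \<notin> successors (g u) v"
      using g[OF uv(1)] g[OF uv(2)] F uv by (auto simp: successors_def)
    then show False using ferrers_digraphD[OF F(1), of u v] F(2) uv by blast
  qed
  moreover have "g ` ?V \<subseteq> \<F>" "finite \<F>" using g fam by (auto simp: ferrers_family_def)
  ultimately show "card ?V \<le> k" using k card_inj_on_le by blast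
qed

text \<open>The complement consists of loops only, and two loops without an arc between their
  vertices form an identity submatrix. Single loops give the optimal partition.\<close>

lemma disjoint_ferrers_dimension_eq:
  assumes fin: "finite (pverts D)"
    and D: "parcs D = {(u, v) \<in> pverts D \<times> pverts D. u \<noteq> v}"
  shows "disjoint_ferrers_dimension D = card (pverts D)"
  unfolding disjoint_ferrers_dimension_def
proof (rule Least_equality)
  let ?V = "pverts D"
  let ?F = "\<lambda>v. \<lparr>pverts = ?V, parcs = {(v, v)}\<rparr>"
  have "ferrers_digraph (?F v)" if "v \<in> ?V" for v
  proof -
    have "pair_fin_digraph (?F v)" by unfold_locales (use fin that in auto)
    moreover have "successors (?F v) u = (if u = v then {v} else {})" if "u \<in> ?V" for u
      using that by (auto simp: successors_def)
    ultimately show ?thesis by (auto simp: ferrers_digraph_def chain_subset_def)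
  qed
  then have "ferrers_family ?V (?F ` ?V)" using fin by (auto simp: ferrers_family_def)
  moreover have "card (?F ` ?V) = card ?V" by (rule card_image) (auto simp: inj_on_def)
  moreover have "pairwise (\<lambda>F G. parcs F \<inter> parcs G = {}) (?F ` ?V)" by (auto simp: pairwise_def)
  moreover have "(\<Union>F\<in>?F ` ?V. parcs F) = complement_arcs D"
    by (auto simp: complement_arcs_def D)
  ultimately show "\<exists>\<F>. ferrers_family ?V \<F> \<and> card \<F> = card ?V \<and>
      pairwise (\<lambda>F G. parcs F \<inter> parcs G = {}) \<F> \<and> (\<Union>F\<in>\<F>. parcs F) = complement_arcs D"
    by blast
next
  let ?V = "pverts D"
  fix k assume "\<exists>\<F>. ferrers_family ?V \<F> \<and> card \<F> = k \<and>
      pairwise (\<lambda>F G. parcs F \<inter> parcs G = {}) \<F> \<and> (\<Union>F\<in>\<F>. parcs F) = complement_arcs D"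
  then obtain \<F> where fam: "ferrers_family ?V \<F>" and k: "card \<F> = k"
    and un: "(\<Union>F\<in>\<F>. parcs F) = complement_arcs D" by blast
  have compl: "complement_arcs D = {(v, v) | v. v \<in> ?V}" by (auto simp: complement_arcs_def D)
  have "\<exists>F. F \<in> \<F> \<and> (v, v) \<in> parcs F" if "v \<in> ?V" for v
    using un that unfolding compl by blast
  then obtain g where g: "\<And>v. v \<in> ?V \<Longrightarrow> g v \<in> \<F> \<and> (v, v) \<in> parcs (g v)" by metis
  have "inj_on g ?V"
  proof (rule inj_onI, rule ccontr)
    fix u v assume uv: "u \<in> ?V" "v \<in> ?V" "g u = g v" "u \<noteq> v"
    have F: "ferrers_digraph (g u)" "pverts (g u) = ?V"
      using fam g uv by (auto simp: ferrers_family_def)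
    have "(u, v) \<notin> parcs (g u)" "(v, u) \<notin> parcs (g u)"
      using un g[OF uv(1)] uv(4) unfolding compl by blast+
    then have "v \<notin> successors (g u) u" "u \<notin> successors (g u) v"
      "u \<in> successors (g u) u" "v \<in> successors (g u) v"
      using g[OF uv(1)] g[OF uv(2)] F uv by (auto simp: successors_def)
    then show False using ferrers_digraphD[OF F(1), of u v] F(2) uv by blast
  qed
  moreover have "g ` ?V \<subseteq> \<F>" "finite \<F>" using g fam by (auto simp: ferrers_family_def)
  ultimately show "card ?V \<le> k" using k card_inj_on_le by blast
qed

section \<open>Width of the incidence poset\<close>

lemma width_antichain:
  assumes "finite P" "antichain P"
  shows "width P = card P"
  unfolding width_def
proof (rule Max_eqI)
  show "finite (card ` {A. A \<subseteq> P \<and> antichain A})" using assms by simp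
  show "k \<le> card P" if "k \<in> card ` {A. A \<subseteq> P \<and> antichain A}" for k
    using that assms by (auto intro: card_mono)
  show "card P \<in> card ` {A. A \<subseteq> P \<and> antichain A}" using assms by blast
qed

text \<open>The predecessor sets are the complements of single vertices: pairwise distinct and
  incomparable, so the whole poset is an antichain.\<close>

lemma width_incidence_poset_eq:
  assumes fin: "finite (pverts D)"
    and D: "parcs D = {(u, v) \<in> pverts D \<times> pverts D. u \<noteq> v}"
  shows "width (incidence_poset D) = card (pverts D)"
proof -
  have pred: "predecessors D v = pverts D - {v}" if "v \<in> pverts D" for v
    using that by (auto simp: predecessors_def D)
  have "antichain (incidence_poset D)"
    by (auto simp: antichain_def incidence_poset_def pairwise_def pred)
  moreover have "inj_on (predecessors D) (pverts D)"
    by (auto simp: inj_on_def pred)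
  ultimately show ?thesis
    using fin by (simp add: width_antichain incidence_poset_def card_image)
qed

theorem mainTheorem7:
  fixes n :: nat and D :: "'a pair_pre_digraph"
  assumes "n \<ge> 3"
    and "pair_fin_digraph D"
    and "card (pverts D) = n"
    and "\<forall>u\<in>pverts D. \<forall>v\<in>pverts D. adjacency_matrix D u v = 1 - (if u = v then 1 else 0)"
  shows "ferrers_dimension D = n \<and> disjoint_ferrers_dimension D = n \<and> leafage D = n \<and>
    catch_leafage D = n \<and> width (incidence_poset D) = n"
proof -
  interpret pair_fin_digraph D by (fact assms(2))
  have iff: "(u, v) \<in> parcs D \<longleftrightarrow> u \<noteq> v" if "u \<in> pverts D" "v \<in> pverts D" for u v
    using assms(4) that by (auto simp: adjacency_matrix_def split: if_splits)
  have "(u, v) \<in> parcs D \<longleftrightarrow> u \<in> pverts D \<and> v \<in> pverts D \<and> u \<noteq> v" for u v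
    using iff[of u v] in_arcsD1[of u v] in_arcsD2[of u v] by blast
  then have D: "parcs D = {(u, v) \<in> pverts D \<times> pverts D. u \<noteq> v}" by auto
  note fin = pair_finite_verts
  \<comment> \<open>One catch representation attains both leafages, since it is in particular a
    subtree representation; \<open>lower\<close> bounds both in the same way.\<close>
  have star: "\<exists>(T :: nat pair_pre_digraph) S R. undirected_tree T \<and> card (leaves T) = n \<and>
    subtree_representation D T S R \<and> (\<forall>v\<in>pverts D. is_singleton (pverts (R v)))"
    using star_catch_representation[OF fin _ D] assms(1,3) by simp
  have lower: "n \<le> card (leaves T)"
    if "undirected_tree T" "subtree_representation D T S R" for T :: "nat pair_pre_digraph" and S R
    using card_le_leaves[OF that D] assms(3) by simp
  have "leafage D = n"
    unfolding leafage_def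
    by (rule Least_equality) (use star lower in blast)+
  moreover have "catch_leafage D = n"
    unfolding catch_leafage_def
    by (rule Least_equality) (use star lower in blast)+
  ultimately show ?thesis
    using ferrers_dimension_eq[OF fin D] disjoint_ferrers_dimension_eq[OF fin D]
      width_incidence_poset_eq[OF fin D] assms(3) by simp
qed

end
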